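(* Let $\vec{P}$ be an oriented path. Then there exists an acyclic outerplanar digraph $\vec{O}(\vec{P})$ such that for every coloring of the vertices of $\vec{O}(\vec{P})$ with $2$ colors, there is a monochromatic induced copy of $\vec{P}$ in $\vec{O}(\vec{P})$, i.e., an induced subdigraph of $\vec{O}(\vec{P})$ that is isomorphic to $\vec{P}$ and all of whose vertices have the same color.
   Context: All digraphs are finite and simple: no loops, no parallel arcs and no anti-parallel arcs. An oriented path is an orientation of an undirected path (arcs may be oriented arbitrarily, not necessarily consistently). An outerplanar digraph is an orientation of an outerplanar graph, i.e., of a graph which can be drawn in the plane with no edges intersecting and all vertices on the outer face. A digraph is acyclic if it contains no directed cycle. Vertex-colorings are arbitrary maps to the color set (not necessarily proper). *)

theory Defs
  imports "HOL-Analysis.Analysis" "Graph_Theory.Digraph_Isomorphism"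
begin

text \<open>
  Finite digraphs without loops and parallel arcs are the library's \<^locale>\<open>digraph\<close>;
  anti-parallel arcs have to be excluded separately.
\<close>

locale oriented_graph = digraph +
  assumes asym_arcs_ends: "asym (arcs_ends G)"

text \<open>
  The underlying undirected graph of an oriented graph \<open>G\<close> has the vertex set \<open>verts G\<close> and
  the two-element sets in \<open>uedges G\<close> as edges. Each edge stems from exactly one arc.
\<close>

definition uedges :: "('a, 'b) pre_digraph \<Rightarrow> 'a set set" where
  "uedges G = (\<lambda>a. {tail G a, head G a}) ` arcs G"

definition path_graph :: "'a set \<Rightarrow> 'a set set \<Rightarrow> bool" where
  "path_graph V E \<longleftrightarrow>
     (\<exists>p. p \<noteq> [] \<and> distinct p \<and> V = set p \<and> E = {{p ! i, p ! Suc i} | i. Suc i < length p})"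

definition oriented_path :: "('a, 'b) pre_digraph \<Rightarrow> bool" where
  "oriented_path P \<longleftrightarrow> oriented_graph P \<and> path_graph (verts P) (uedges P)"

text \<open>
  A crossing-free drawing of an undirected graph in the plane, here \<^typ>\<open>complex\<close>: \<open>pos\<close> places
  the vertices, and \<open>\<gamma> e\<close> is a simple arc joining the two ends of the edge \<open>e\<close>. An edge meets
  the vertices only in its ends, and two edges meet only in their common ends.
\<close>

definition plane_drawing ::
  "'a set \<Rightarrow> 'a set set \<Rightarrow> ('a \<Rightarrow> complex) \<Rightarrow> ('a set \<Rightarrow> real \<Rightarrow> complex) \<Rightarrow> bool" where
  "plane_drawing V E pos \<gamma> \<longleftrightarrow>
     inj_on pos V \<and>
     (\<forall>e\<in>E. arc (\<gamma> e) \<and> {pathstart (\<gamma> e), pathfinish (\<gamma> e)} = pos ` e \<and>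
             path_image (\<gamma> e) \<inter> pos ` V = pos ` e) \<and>
     (\<forall>e\<in>E. \<forall>f\<in>E. e \<noteq> f \<longrightarrow> path_image (\<gamma> e) \<inter> path_image (\<gamma> f) = pos ` (e \<inter> f))"

definition drawing_image ::
  "'a set \<Rightarrow> 'a set set \<Rightarrow> ('a \<Rightarrow> complex) \<Rightarrow> ('a set \<Rightarrow> real \<Rightarrow> complex) \<Rightarrow> complex set" where
  "drawing_image V E pos \<gamma> = pos ` V \<union> (\<Union>e\<in>E. path_image (\<gamma> e))"

text \<open>
  For a finite graph the drawing is compact, so \<^const>\<open>outside\<close> of it, the union of the
  unbounded components of the complement, is the single unbounded (outer) face.
\<close>

definition outerplanar :: "'a set \<Rightarrow> 'a set set \<Rightarrow> bool" where
  "outerplanar V E \<longleftrightarrow>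
     (\<exists>pos \<gamma>. plane_drawing V E pos \<gamma> \<and>
              pos ` V \<subseteq> frontier (outside (drawing_image V E pos \<gamma>)))"

definition outerplanar_digraph :: "('a, 'b) pre_digraph \<Rightarrow> bool" where
  "outerplanar_digraph D \<longleftrightarrow> oriented_graph D \<and> outerplanar (verts D) (uedges D)"

definition acyclic_digraph :: "('a, 'b) pre_digraph \<Rightarrow> bool" where
  "acyclic_digraph D \<longleftrightarrow> \<not> (\<exists>p. pre_digraph.cycle D p)"

end

theory Submission
  imports Defs
begin

text \<open>
  Call the vertices of \<open>P\<close>, in path order, \<open>p\<^sub>0, \<dots>, p\<^sub>m\<close>. Rooted digraphs \<open>D\<^sub>k\<close> are built
  by recursion: \<open>D\<^sub>m\<close> is a single root, and \<open>D\<^sub>k\<close> has a root joined to all vertices of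
  a copy of \<open>P\<close>, all these arcs being directed like the one between \<open>p\<^sub>k\<close> and \<open>p\<^bsub>k+1\<^esub>\<close>, and
  each vertex of this copy being the root of a private copy of \<open>D\<^bsub>k+1\<^esub>\<close>. If no neighbour of the
  root of \<open>D\<^sub>k\<close> has the colour of the root, then these neighbours form a monochromatic copy of
  \<open>P\<close>; otherwise one continues from a neighbour of that colour. Hence a colouring of \<open>D\<^sub>0\<close> without
  such a copy has a monochromatic copy of \<open>P\<close> starting at the root.

  For outerplanarity, the vertices are listed so that each root precedes its neighbours
  and each private copy is an interval. Then no two edges cross as intervals, so straight chords
  between points of a parabola are a drawing.
\<close>

section \<open>Drawing non-crossing edges as chords of a parabola\<close>

definition parabola :: "nat \<Rightarrow> complex" where
  "parabola a = Complex (real a) ((real a)\<^sup>2)"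

lemma inj_parabola: "inj parabola"
  by (auto simp: inj_def parabola_def)

text \<open>At parameter \<open>u\<close> the chord exceeds the parabola by
  \<open>u * (1 - u) * (b - a)\<^sup>2\<close>. Written as a product in \<open>Re z\<close>, this
  excess lets two chords be compared at a common abscissa.\<close>

lemma chord_parabolaD:
  assumes "a < b" "z \<in> closed_segment (parabola a) (parabola b)"
  shows "real a \<le> Re z" "Re z \<le> real b" "Im z = (Re z)\<^sup>2 + (Re z - a) * (b - Re z)"
proof -
  obtain u where u: "0 \<le> u" "u \<le> 1" and z: "z = (1 - u) *\<^sub>R parabola a + u *\<^sub>R parabola b"
    using assms(2) by (auto simp: closed_segment_def)
  have re: "Re z = real a + u * (real b - real a)"
    by (simp add: z parabola_def algebra_simps)
  have "0 \<le> u * (real b - real a)" "u * (real b - real a) \<le> 1 * (real b - real a)"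
    using u assms(1) by (auto intro: mult_right_mono)
  then show "real a \<le> Re z" "Re z \<le> real b"
    using re by auto
  have "Im z = (1 - u) * (real a)\<^sup>2 + u * (real b)\<^sup>2"
    by (simp add: z parabola_def)
  then show "Im z = (Re z)\<^sup>2 + (Re z - a) * (b - Re z)"
    by (simp add: re algebra_simps power2_eq_square)
qed

text \<open>The two sides of \<open>eq\<close> differ by
  \<open>(c - a) * (b - x) + (x - c) * (b - d)\<close>. Both terms are nonnegative, so equality
  makes both vanish.\<close>

lemma nested_chords_meet:
  fixes x :: real
  assumes "a \<le> c" "d \<le> b" "c \<le> x" "x \<le> d" "(a, b) \<noteq> (c, d)" "c < d"
    and eq: "(x - a) * (b - x) = (x - c) * (d - x)"
  shows "x = a \<and> x = c \<or> x = b \<and> x = d"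
proof -
  have "(x - a) * (b - x) = (x - c) * (d - x) + (c - a) * (b - x) + (x - c) * (b - d)"
    by (simp add: algebra_simps)
  moreover have "0 \<le> (c - a) * (b - x)" "0 \<le> (x - c) * (b - d)"
    using assms by auto
  ultimately have "(c - a) * (b - x) = 0" "(x - c) * (b - d) = 0"
    using eq by linarith+
  then show ?thesis
    using assms by auto
qed

lemma chords_meet:
  assumes "a < b" "c < d" "(a, b) \<noteq> (c, d)"
    and "\<not> (a < c \<and> c < b \<and> b < d)" "\<not> (c < a \<and> a < d \<and> d < b)"
    and z: "z \<in> closed_segment (parabola a) (parabola b)"
           "z \<in> closed_segment (parabola c) (parabola d)"
  shows "z \<in> parabola ` ({a, b} \<inter> {c, d})"
proof -
  note ab = chord_parabolaD[OF \<open>a < b\<close> z(1)] and cd = chord_parabolaD[OF \<open>c < d\<close> z(2)]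
  have eq: "(Re z - a) * (b - Re z) = (Re z - c) * (d - Re z)"
    using ab(3) cd(3) by simp
  have ends: "z = parabola v" if "Re z = real v" "v \<in> {a, b}" for v
    using that ab(3) by (auto simp: parabola_def complex_eq_iff)
  \<comment> \<open>Intervals that do not interlace lie side by side or are nested.\<close>
  consider "b \<le> c" | "d \<le> a" | "a \<le> c" "d \<le> b" | "c \<le> a" "b \<le> d"
    using assms(1-5) by (meson linorder_le_less_linear linorder_neqE_nat nless_le)
  then show ?thesis
  proof cases
    case 1
    then have "Re z = real b" "b = c"
      using ab cd by auto
    then show ?thesis using ends by auto
  next
    case 2
    then have "Re z = real a" "a = d"
      using ab cd by auto
    then show ?thesis using ends by auto
  next
    case 3
    then have "Re z = a \<and> Re z = c \<or> Re z = b \<and> Re z = d"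
      using assms(2,3) cd eq by (intro nested_chords_meet) auto
    then show ?thesis using ends by auto
  next
    case 4
    then have "Re z = c \<and> Re z = a \<or> Re z = d \<and> Re z = b"
      using assms(1,3) ab eq by (intro nested_chords_meet) auto
    then show ?thesis using ends by auto
  qed
qed

text \<open>Serves to locate the outer face: the complement of a convex set containing the drawing
  lies outside the drawing.\<close>

lemma convex_above_parabola: "convex {z. (Re z)\<^sup>2 \<le> Im z}"
proof (rule convexI)
  fix x y :: complex and u v :: real
  assume xy: "x \<in> {z. (Re z)\<^sup>2 \<le> Im z}" "y \<in> {z. (Re z)\<^sup>2 \<le> Im z}"
    and u: "0 \<le> u" and v: "0 \<le> v" and uv: "u + v = 1"
  have v': "v = 1 - u" using uv by simp
  have "(u * Re x + v * Re y)\<^sup>2 = u * (Re x)\<^sup>2 + v * (Re y)\<^sup>2 - u * v * (Re x - Re y)\<^sup>2"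
    unfolding v' by (simp add: algebra_simps power2_eq_square)
  also have "\<dots> \<le> u * Im x + v * Im y"
    using xy u v by (smt (verit) mem_Collect_eq mult_left_mono mult_nonneg_nonneg zero_le_power2)
  finally show "u *\<^sub>R x + v *\<^sub>R y \<in> {z. (Re z)\<^sup>2 \<le> Im z}"
    by simp
qed

text \<open>Points straight below \<open>parabola a\<close> lie outside \<open>S\<close> and come
  arbitrarily close to \<open>parabola a\<close>, which belongs to \<open>S\<close> and hence is not
  outside.\<close>

lemma parabola_in_frontier_outside:
  assumes "S \<subseteq> {z. (Re z)\<^sup>2 \<le> Im z}" "parabola a \<in> S"
  shows "parabola a \<in> frontier (outside S)"
proof -
  have below: "- {z. (Re z)\<^sup>2 \<le> Im z} \<subseteq> outside S"
    using outside_subset_convex[OF convex_above_parabola assms(1)] .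
  have "parabola a \<in> closure (outside S)"
    unfolding closure_approachable
  proof (intro allI impI)
    fix e :: real assume "0 < e"
    let ?y = "parabola a - Complex 0 (e / 2)"
    have "?y \<in> outside S"
      using below \<open>0 < e\<close> by (auto simp: parabola_def)
    moreover have "dist ?y (parabola a) < e"
      using \<open>0 < e\<close> by (simp add: dist_norm cmod_def)
    ultimately show "\<exists>y\<in>outside S. dist y (parabola a) < e" by blast
  qed
  moreover have "parabola a \<notin> outside S"
    using assms(2) outside_no_overlap by blast
  ultimately show ?thesis
    using interior_subset by (auto simp: frontier_def)
qed

lemma outerplanar_noncrossing:
  fixes V :: "nat set"
  assumes edge: "\<And>e. e \<in> E \<Longrightarrow> \<exists>a\<in>V. \<exists>b\<in>V. a < b \<and> e = {a, b}"
    and noncrossing: "\<And>a b c d. {a, b} \<in> E \<Longrightarrow> {c, d} \<in> E \<Longrightarrow> \<not> (a < c \<and> c < b \<and> b < d)"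
  shows "outerplanar V E"
proof -
  \<comment> \<open>An edge is an unordered set; \<open>Min\<close> and \<open>Max\<close> recover
    its left and right end.\<close>
  define \<gamma> where "\<gamma> e = linepath (parabola (Min e)) (parabola (Max e))" for e :: "nat set"
  have \<gamma>: "\<gamma> {a, b} = linepath (parabola a) (parabola b)" if "a < b" for a b
    using that by (simp add: \<gamma>_def)
  have inj: "parabola a = parabola b \<longleftrightarrow> a = b" for a b
    using inj_parabola by (auto dest: injD)
  have "plane_drawing V E parabola \<gamma>"
    unfolding plane_drawing_def
  proof (intro conjI ballI impI)
    show "inj_on parabola V" using inj_parabola by (rule inj_on_subset) simp
  next
    fix e assume "e \<in> E"
    then obtain a b where ab: "a \<in> V" "b \<in> V" "a < b" "e = {a, b}"
      using edge by blast
    then show "arc (\<gamma> e)"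
      by (simp add: \<gamma> arc_linepath inj)
    show "{pathstart (\<gamma> e), pathfinish (\<gamma> e)} = parabola ` e"
      using ab by (simp add: \<gamma>)
    \<comment> \<open>A point of the parabola has excess zero, so \<open>(v - a) * (b - v)\<close>
      vanishes.\<close>
    have "v = a \<or> v = b" if "parabola v \<in> closed_segment (parabola a) (parabola b)" for v
      using chord_parabolaD(3)[OF ab(3) that] by (simp add: parabola_def) linarith
    then show "path_image (\<gamma> e) \<inter> parabola ` V = parabola ` e"
      using ab by (auto simp: \<gamma>)
  next
    fix e f assume "e \<in> E" "f \<in> E" "e \<noteq> f"
    then obtain a b c d where ab: "a < b" "e = {a, b}" and cd: "c < d" "f = {c, d}"
      using edge by metis
    show "path_image (\<gamma> e) \<inter> path_image (\<gamma> f) = parabola ` (e \<inter> f)"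
    proof
      show "path_image (\<gamma> e) \<inter> path_image (\<gamma> f) \<subseteq> parabola ` (e \<inter> f)"
      proof
        fix z assume "z \<in> path_image (\<gamma> e) \<inter> path_image (\<gamma> f)"
        then show "z \<in> parabola ` (e \<inter> f)"
          using chords_meet[of a b c d z] noncrossing[of a b c d] noncrossing[of c d a b]
            \<open>e \<in> E\<close> \<open>f \<in> E\<close> \<open>e \<noteq> f\<close> ab cd by (auto simp: \<gamma>)
      qed
      show "parabola ` (e \<inter> f) \<subseteq> path_image (\<gamma> e) \<inter> path_image (\<gamma> f)"
        using ab cd by (auto simp: \<gamma>)
    qed
  qed
  moreover have "parabola ` V \<subseteq> frontier (outside (drawing_image V E parabola \<gamma>))"
  proof -
    have "drawing_image V E parabola \<gamma> \<subseteq> {z. (Re z)\<^sup>2 \<le> Im z}"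
    proof
      fix z assume "z \<in> drawing_image V E parabola \<gamma>"
      then consider "z \<in> parabola ` V" | e where "e \<in> E" "z \<in> path_image (\<gamma> e)"
        by (auto simp: drawing_image_def)
      then show "z \<in> {z. (Re z)\<^sup>2 \<le> Im z}"
      proof cases
        case 1
        then show ?thesis by (auto simp: parabola_def)
      next
        case 2
        then obtain a b where "a < b" "e = {a, b}"
          using edge by metis
        then show ?thesis
          using 2 chord_parabolaD[of a b z] by (simp add: \<gamma>)
      qed
    qed
    then show ?thesis
      by (auto intro!: parabola_in_frontier_outside simp: drawing_image_def)
  qed
  ultimately show ?thesis
    unfolding outerplanar_def by blast
qed

section \<open>Digraphs given by arc sets\<close>

definition arc_digraph :: "nat \<Rightarrow> (nat \<times> nat) set \<Rightarrow> (nat, nat \<times> nat) pre_digraph" where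
  "arc_digraph n A = \<lparr>verts = {..<n}, arcs = A, tail = fst, head = snd\<rparr>"

lemma arc_digraph_simps [simp]:
  "verts (arc_digraph n A) = {..<n}" "arcs (arc_digraph n A) = A"
  "tail (arc_digraph n A) = fst" "head (arc_digraph n A) = snd"
  by (simp_all add: arc_digraph_def)

text \<open>Arcs are read as intervals whatever their orientation, hence the converse. Strict
  inequalities permit common ends.\<close>

definition noncrossing :: "(nat \<times> nat) set \<Rightarrow> bool" where
  "noncrossing A \<longleftrightarrow> (\<forall>(a, b)\<in>A \<union> A\<inverse>. \<forall>(c, d)\<in>A \<union> A\<inverse>. \<not> (a < c \<and> c < b \<and> b < d))"

text \<open>A certificate of acyclicity that also rules out loops and anti-parallel arcs. Integer
  values leave room for a new root below its neighbours.\<close>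

definition ranking :: "(nat \<times> nat) set \<Rightarrow> (nat \<Rightarrow> int) \<Rightarrow> bool" where
  "ranking A r \<longleftrightarrow> (\<forall>u v. (u, v) \<in> A \<longrightarrow> r u < r v)"

lemma wf_arc_digraph:
  assumes "A \<subseteq> {..<n} \<times> {..<n}"
  shows "wf_digraph (arc_digraph n A)"
  using assms by unfold_locales auto

lemma oriented_arc_digraph:
  assumes "A \<subseteq> {..<n} \<times> {..<n}" "ranking A r"
  shows "oriented_graph (arc_digraph n A)"
proof -
  interpret wf_digraph "arc_digraph n A"
    using assms(1) by (rule wf_arc_digraph)
  have ends: "arcs_ends (arc_digraph n A) = A"
    by (auto simp: arcs_ends_def arc_to_ends_def)
  show ?thesis
  proof unfold_locales
    show "finite (arcs (arc_digraph n A))"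
      using assms(1) by (auto intro: finite_subset)
    show "asym (arcs_ends (arc_digraph n A))"
      unfolding ends using assms(2) by (intro asymI) (meson ranking_def less_asym)
  qed (use assms in \<open>force simp: ranking_def arc_to_ends_def\<close>)+
qed

lemma acyclic_arc_digraph:
  assumes "A \<subseteq> {..<n} \<times> {..<n}" "ranking A r"
  shows "acyclic_digraph (arc_digraph n A)"
proof -
  let ?G = "arc_digraph n A"
  \<comment> \<open>The strict part excludes nonempty closed walks; the weak part handles an empty
    remaining walk in the induction.\<close>
  have "r u \<le> r v \<and> (p \<noteq> [] \<longrightarrow> r u < r v)"
    if "set p \<subseteq> A" "pre_digraph.cas ?G u p v" for u p v
    using that
  proof (induction p arbitrary: u)
    case Nil
    then show ?case by (simp add: pre_digraph.cas.simps)
  next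
    case (Cons a p)
    then have "fst a = u" "r (snd a) \<le> r v" "a \<in> A"
      by (auto simp: pre_digraph.cas.simps)
    then show ?case
      using assms(2) unfolding ranking_def by (metis order.strict_trans1 order.trans order.strict_implies_order prod.collapse list.distinct(1) order.strict_trans2)
  qed
  then show ?thesis
    by (fastforce simp: acyclic_digraph_def pre_digraph.cycle_def pre_digraph.awalk_def)
qed

lemma outerplanar_arc_digraph:
  assumes "A \<subseteq> {..<n} \<times> {..<n}" "ranking A r" "noncrossing A"
  shows "outerplanar_digraph (arc_digraph n A)"
  unfolding outerplanar_digraph_def
proof
  show "oriented_graph (arc_digraph n A)"
    using assms(1,2) by (rule oriented_arc_digraph)
  have edge_iff: "{a, b} \<in> uedges (arc_digraph n A) \<longleftrightarrow> (a, b) \<in> A \<union> A\<inverse>" for a b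
    by (force simp: uedges_def doubleton_eq_iff)
  show "outerplanar (verts (arc_digraph n A)) (uedges (arc_digraph n A))"
  proof (rule outerplanar_noncrossing)
    fix e assume "e \<in> uedges (arc_digraph n A)"
    then obtain u v where uv: "(u, v) \<in> A" "e = {u, v}"
      by (auto simp: uedges_def)
    then have "u \<noteq> v" "u < n" "v < n"
      using assms(1,2) by (auto simp: ranking_def)
    then have "min u v < max u v" "e = {min u v, max u v}"
      using uv by (auto simp: min_def max_def)
    then show "\<exists>a\<in>verts (arc_digraph n A). \<exists>b\<in>verts (arc_digraph n A). a < b \<and> e = {a, b}"
      using \<open>u < n\<close> \<open>v < n\<close> by (intro bexI[of _ "min u v"] bexI[of _ "max u v"]) auto
  next
    fix a b c d
    assume "{a, b} \<in> uedges (arc_digraph n A)" "{c, d} \<in> uedges (arc_digraph n A)"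
    then show "\<not> (a < c \<and> c < b \<and> b < d)"
      using assms(3) unfolding edge_iff noncrossing_def by blast
  qed
qed

text \<open>In both digraphs an ordered pair of vertices carries at most one arc, so
  \<open>g\<close> determines the map on arcs. As \<open>ends\<close> covers all pairs of vertices,
  the copy is induced.\<close>

lemma digraph_iso_induce_arc_digraph:
  assumes P: "digraph P" and g: "inj_on g (verts P)"
    and ends: "\<And>u v. u \<in> verts P \<Longrightarrow> v \<in> verts P \<Longrightarrow> (g u, g v) \<in> A \<longleftrightarrow> (u, v) \<in> arcs_ends P"
  shows "digraph_iso (arc_digraph n A \<restriction> g ` verts P) P"
proof -
  interpret P: digraph P by (rule P)
  define f where "f = \<lparr>iso_verts = g, iso_arcs = \<lambda>a. (g (tail P a), g (head P a)),
    iso_head = snd, iso_tail = fst\<rparr>"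
  have "P.digraph_isomorphism f"
    unfolding P.digraph_isomorphism_def
  proof (intro conjI)
    show "inj_on (iso_arcs f) (arcs P)"
      by (auto simp: f_def inj_on_def arc_to_ends_def inj_on_eq_iff[OF g] intro!: P.no_multi_arcs)
  qed (use g P.wf_digraph in \<open>auto simp: f_def\<close>)
  moreover have "app_iso f P = arc_digraph n A \<restriction> g ` verts P"
  proof -
    have "(\<lambda>a. (g (tail P a), g (head P a))) ` arcs P = {a \<in> A. fst a \<in> g ` verts P \<and> snd a \<in> g ` verts P}"
    proof (intro equalityI subsetI)
      fix x assume "x \<in> (\<lambda>a. (g (tail P a), g (head P a))) ` arcs P"
      then show "x \<in> {a \<in> A. fst a \<in> g ` verts P \<and> snd a \<in> g ` verts P}"
        using ends by (auto simp: P.in_arcs_imp_in_arcs_ends)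
    next
      fix x assume "x \<in> {a \<in> A. fst a \<in> g ` verts P \<and> snd a \<in> g ` verts P}"
      then obtain u v where "u \<in> verts P" "v \<in> verts P" "x = (g u, g v)" "(u, v) \<in> arcs_ends P"
        using ends by (cases x) auto
      then show "x \<in> (\<lambda>a. (g (tail P a), g (head P a))) ` arcs P"
        by (auto simp: arcs_ends_def arc_to_ends_def)
    qed
    then show ?thesis
      by (simp add: app_iso_def induce_subgraph_def f_def)
  qed
  ultimately have "digraph_iso P (arc_digraph n A \<restriction> g ` verts P)"
    unfolding digraph_iso_def by metis
  then show ?thesis
    using digraph_iso_swap P.wf_digraph by blast
qed

section \<open>The fan over a path with rooted digraphs attached\<close>

text \<open>Encodes an oriented path on \<open>{..length ds}\<close>, with one vertex more than
  directions; a true entry is an arc pointing away from \<open>0\<close>.\<close>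

definition path_arc :: "bool list \<Rightarrow> nat \<Rightarrow> nat \<Rightarrow> bool" where
  "path_arc ds i j \<longleftrightarrow>
     j = Suc i \<and> i < length ds \<and> ds ! i \<or> i = Suc j \<and> j < length ds \<and> \<not> ds ! j"

definition induced_path :: "nat \<Rightarrow> (nat \<times> nat) set \<Rightarrow> bool list \<Rightarrow> (nat \<Rightarrow> nat) \<Rightarrow> bool" where
  "induced_path n A ds h \<longleftrightarrow> inj_on h {..length ds} \<and> h ` {..length ds} \<subseteq> {..<n} \<and>
     (\<forall>i\<le>length ds. \<forall>j\<le>length ds. (h i, h j) \<in> A \<longleftrightarrow> path_arc ds i j)"

text \<open>The invariant of the recursion: \<open>ds\<close> is the whole path and
  \<open>bs\<close> the part still to be found from the root \<open>0\<close>. For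
  \<open>bs = ds\<close> both alternatives give a monochromatic copy of the path.\<close>

definition path_or_rooted_path :: "bool list \<Rightarrow> bool list \<Rightarrow> nat \<Rightarrow> (nat \<times> nat) set \<Rightarrow> bool" where
  "path_or_rooted_path ds bs n A \<longleftrightarrow> (\<forall>c :: nat \<Rightarrow> bool.
     (\<exists>h. induced_path n A ds h \<and> (\<forall>i\<le>length ds. c (h i) = c (h 0))) \<or>
     (\<exists>h. induced_path n A bs h \<and> h 0 = 0 \<and> (\<forall>i\<le>length bs. c (h i) = c 0)))"

lemma path_arc_irrefl [simp]: "\<not> path_arc ds i i"
  by (auto simp: path_arc_def)

lemma path_arc_Cons [simp]:
  "path_arc (b # bs) 0 (Suc j) \<longleftrightarrow> b \<and> j = 0"
  "path_arc (b # bs) (Suc i) 0 \<longleftrightarrow> \<not> b \<and> i = 0"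
  "path_arc (b # bs) (Suc i) (Suc j) \<longleftrightarrow> path_arc bs i j"
  by (auto simp: path_arc_def)

lemma path_arc_bounds: "path_arc ds i j \<Longrightarrow> i \<le> length ds \<and> j \<le> length ds"
  by (auto simp: path_arc_def)

text \<open>One step of the recursion: \<open>A\<close> with root \<open>0\<close> is the digraph to
  be attached, and \<open>b\<close> tells whether the arcs at the new root leave it.\<close>

locale fan =
  fixes ds :: "bool list" and b :: bool and s :: nat and A :: "(nat \<times> nat) set" and r :: "nat \<Rightarrow> int"
  assumes s_pos: "0 < s" and A_bounds: "A \<subseteq> {..<s} \<times> {..<s}"
    and rank: "ranking A r" and A_noncrossing: "noncrossing A"
begin

text \<open>The fan has the root \<open>0\<close>; the vertex \<open>x\<close> of the \<open>i\<close>-th attached digraph becomes \<open>slot i x\<close>.\<close>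

definition slot :: "nat \<Rightarrow> nat \<Rightarrow> nat" where
  "slot i x = Suc (i * s + x)"

definition fan_size :: nat where
  "fan_size = Suc (Suc (length ds) * s)"

definition fan_arcs :: "(nat \<times> nat) set" where
  "fan_arcs =
     {(0, slot i 0) | i. b \<and> i \<le> length ds} \<union> {(slot i 0, 0) | i. \<not> b \<and> i \<le> length ds} \<union>
     {(slot i 0, slot j 0) | i j. path_arc ds i j} \<union>
     {(slot i x, slot i y) | i x y. i \<le> length ds \<and> (x, y) \<in> A}"

lemma slot_pos [simp]: "0 < slot i x" "slot i x \<noteq> 0" "0 \<noteq> slot i x"
  by (auto simp: slot_def)

lemma slot_less: "slot i x < slot j y" if "i < j" "x < s"
proof -
  have "i * s + x < Suc i * s" using that by simp
  also have "\<dots> \<le> j * s" using that by (intro mult_le_mono1) simp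
  finally show ?thesis by (simp add: slot_def)
qed

text \<open>The attached copies fill consecutive blocks of length \<open>s\<close>, so vertices
  other than the root compare lexicographically.\<close>

lemma slot_less_iff: "slot i x < slot j y \<longleftrightarrow> i < j \<or> i = j \<and> x < y" if "x < s" "y < s"
  using slot_less[of i j x y] slot_less[of j i y x] that
  by (cases i j rule: linorder_cases) (auto simp: slot_def)

lemma slot_eq_iff: "slot i x = slot j y \<longleftrightarrow> i = j \<and> x = y" if "x < s" "y < s"
  using slot_less[of i j x y] slot_less[of j i y x] that
  by (cases i j rule: linorder_cases) (auto simp: slot_def)

lemma slot_bound: "slot i x < fan_size" if "i \<le> length ds" "x < s"
  using slot_less[of i "Suc (length ds)" x 0] that by (simp add: slot_def fan_size_def)

lemma fan_size_pos: "0 < fan_size"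
  by (simp add: fan_size_def)

lemma fan_vertex_cases:
  assumes "v < fan_size"
  obtains "v = 0" | i x where "v = slot i x" "i \<le> length ds" "x < s"
proof (cases v)
  case (Suc w)
  \<comment> \<open>With the root removed, quotient and remainder by \<open>s\<close> are the block
    and the position in it.\<close>
  have "w div s < Suc (length ds)"
    using assms Suc by (intro less_mult_imp_div_less) (simp add: fan_size_def)
  then have "w div s \<le> length ds" by simp
  moreover have "v = slot (w div s) (w mod s)" "w mod s < s"
    using Suc s_pos by (auto simp: slot_def)
  ultimately show ?thesis using that(2) by blast
qed (use that in auto)

lemma fan_arcs_bounds: "fan_arcs \<subseteq> {..<fan_size} \<times> {..<fan_size}"
  using A_bounds s_pos fan_size_pos
  by (auto simp: fan_arcs_def intro!: slot_bound dest: path_arc_bounds)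

lemma fan_arcs_root [simp]:
  "(0, 0) \<notin> fan_arcs"
  "x < s \<Longrightarrow> (0, slot i x) \<in> fan_arcs \<longleftrightarrow> b \<and> x = 0 \<and> i \<le> length ds"
  "x < s \<Longrightarrow> (slot i x, 0) \<in> fan_arcs \<longleftrightarrow> \<not> b \<and> x = 0 \<and> i \<le> length ds"
  using s_pos by (auto simp: fan_arcs_def slot_eq_iff)

lemma fan_arcs_slot:
  assumes "x < s" "y < s"
  shows "(slot i x, slot j y) \<in> fan_arcs \<longleftrightarrow>
    i = j \<and> i \<le> length ds \<and> (x, y) \<in> A \<or> x = 0 \<and> y = 0 \<and> path_arc ds i j"
proof
  assume "(slot i x, slot j y) \<in> fan_arcs"
  then consider i' j' where "slot i x = slot i' 0" "slot j y = slot j' 0" "path_arc ds i' j'"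
    | k x' y' where "slot i x = slot k x'" "slot j y = slot k y'" "k \<le> length ds" "(x', y') \<in> A"
    by (auto simp: fan_arcs_def)
  then show "i = j \<and> i \<le> length ds \<and> (x, y) \<in> A \<or> x = 0 \<and> y = 0 \<and> path_arc ds i j"
  proof cases
    case 1
    then show ?thesis using assms s_pos by (simp add: slot_eq_iff)
  next
    case 2
    then have "x' < s" "y' < s" using A_bounds by auto
    then show ?thesis using 2 assms by (simp add: slot_eq_iff)
  qed
qed (auto simp: fan_arcs_def)

text \<open>Each block has its root as least vertex, and an edge leaving a block joins its root to
  the root of a neighbouring block or to \<open>0\<close>. Interlacing within one block is excluded
  by \<open>A_noncrossing\<close>.\<close>

lemma fan_noncrossing: "noncrossing fan_arcs"
proof -
  have False
    if uv: "(u, v) \<in> fan_arcs \<union> fan_arcs\<inverse>" and wz: "(w, z) \<in> fan_arcs \<union> fan_arcs\<inverse>"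
      and less: "u < w" "w < v" "v < z" for u v w z
  proof -
    have bounds: "v < fan_size" "w < fan_size" "z < fan_size" "u < fan_size"
      using uv wz fan_arcs_bounds by auto
    obtain j y where v: "v = slot j y" "j \<le> length ds" "y < s"
      using bounds(1) less by (cases rule: fan_vertex_cases) auto
    obtain k x where w: "w = slot k x" "k \<le> length ds" "x < s"
      using bounds(2) less by (cases rule: fan_vertex_cases) auto
    obtain l t where z: "z = slot l t" "l \<le> length ds" "t < s"
      using bounds(3) less by (cases rule: fan_vertex_cases) auto
    have wv: "k < j \<or> k = j \<and> x < y" and vz: "j < l \<or> j = l \<and> y < t"
      using less v w z by (auto simp: slot_less_iff)
    have wz': "k = l \<and> (x, t) \<in> A \<union> A\<inverse> \<or> x = 0 \<and> t = 0 \<and> (l = Suc k \<or> k = Suc l)"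
      using wz w z by (auto simp: fan_arcs_slot path_arc_def)
    from bounds(4) show False
    proof (cases rule: fan_vertex_cases)
      case 1
      \<comment> \<open>Here \<open>v\<close> is first in its block, so \<open>w\<close> lies in an
        earlier block, from which an edge reaches at most the root of block \<open>j\<close>, that
        is \<open>v\<close>.\<close>
      then have "y = 0" using uv v by auto
      then show False using wv vz wz' by auto
    next
      case (2 i q)
      then have uv': "i = j \<and> (q, y) \<in> A \<union> A\<inverse> \<or> q = 0 \<and> y = 0 \<and> (j = Suc i \<or> i = Suc j)"
        using uv v by (auto simp: fan_arcs_slot path_arc_def)
      have uw: "i < k \<or> i = k \<and> q < x"
        using less 2 w by (auto simp: slot_less_iff)
      show False
      proof (cases "i = j \<and> k = l")
        case True
        then have "q < x \<and> x < y \<and> y < t" "(q, y) \<in> A \<union> A\<inverse>" "(x, t) \<in> A \<union> A\<inverse>"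
          using uw wv vz uv' wz' by auto
        then show False
          using A_noncrossing unfolding noncrossing_def by blast
      next
        case False
        \<comment> \<open>In the remaining cases \<open>w\<close> would have to follow
          \<open>u\<close> in the same block; then it is not the root of that block and has no edge
          leaving it.\<close>
        then show False using uw wv vz uv' wz' by auto
      qed
    qed
  qed
  then show ?thesis unfolding noncrossing_def by blast
qed

text \<open>Forward minus backward arcs give a height \<open>g\<close> along the path. Block
  \<open>i\<close> keeps the ranks \<open>r\<close>, shifted by \<open>g i\<close>, so the arcs
  inside blocks and those between block roots both increase.\<close>

lemma fan_ranking: "\<exists>r'. ranking fan_arcs r'"
proof -
  define g where "g i = (\<Sum>k<i. if ds ! k then 1 else - 1 :: int)" for i
  have g_arc: "g i < g j" if "path_arc ds i j" for i j
    using that by (auto simp: path_arc_def g_def)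
  have g_bound: "\<bar>g i\<bar> \<le> int i" for i
    by (induction i) (auto simp: g_def)
  \<comment> \<open>Exceeds the absolute rank of every block root, and these are the only neighbours
    of \<open>0\<close>.\<close>
  define M where "M = int (length ds) + \<bar>r 0\<bar> + 1"
  define r' where "r' v = (if v = 0 then if b then - M else M
    else g ((v - 1) div s) + r ((v - 1) mod s))" for v
  have r'_slot: "r' (slot i x) = g i + r x" if "x < s" for i x
    using that s_pos by (simp add: r'_def slot_def)
  have M: "\<bar>g i + r 0\<bar> < M" if "i \<le> length ds" for i
    using g_bound[of i] that by (simp add: M_def)
  have "r' u < r' v" if "(u, v) \<in> fan_arcs" for u v
  proof -
    have "u < fan_size" "v < fan_size" using that fan_arcs_bounds by auto
    then show ?thesis
    proof (cases rule: fan_vertex_cases[case_product fan_vertex_cases])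
      case ("1_2" i x)
      then have "b" "x = 0" "i \<le> length ds" using that by auto
      then show ?thesis using "1_2" M[of i] s_pos by (auto simp: r'_slot) (auto simp: r'_def)
    next
      case ("2_1" i x)
      then have "\<not> b" "x = 0" "i \<le> length ds" using that by auto
      then show ?thesis using "2_1" M[of i] s_pos by (auto simp: r'_slot) (auto simp: r'_def)
    next
      case ("2_2" i x j y)
      then show ?thesis
        using that rank g_arc[of i j] by (auto simp: fan_arcs_slot r'_slot ranking_def)
    qed (use that in auto)
  qed
  then show ?thesis by (auto simp: ranking_def)
qed

section \<open>Induced paths in the fan and the colouring step\<close>

lemma induced_path_slot:
  assumes "induced_path s A es h" "i \<le> length ds"
  shows "induced_path fan_size fan_arcs es (\<lambda>k. slot i (h k))"
proof -
  have bound: "h k < s" if "k \<le> length es" for k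
    using assms(1) that by (auto simp: induced_path_def)
  show ?thesis
    using assms bound unfolding induced_path_def
    by (auto simp: inj_on_def slot_eq_iff fan_arcs_slot intro!: slot_bound)
qed

text \<open>Roots of distinct blocks are joined by path arcs only, and \<open>rank\<close> excludes
  the loop \<open>(0, 0)\<close> from \<open>A\<close>.\<close>

lemma induced_path_neighbours: "induced_path fan_size fan_arcs ds (\<lambda>i. slot i 0)"
  using s_pos rank
  by (auto simp: induced_path_def inj_on_def slot_eq_iff fan_arcs_slot ranking_def intro: slot_bound)

text \<open>The only neighbour of the new root in block \<open>i\<close> is the root
  \<open>slot i 0\<close>, and injectivity of \<open>h\<close> keeps the later path vertices
  different from it.\<close>

lemma induced_path_Cons:
  assumes "induced_path s A bs h" "h 0 = 0" "i \<le> length ds"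
  shows "induced_path fan_size fan_arcs (b # bs) (case_nat 0 (\<lambda>k. slot i (h k)))"
proof -
  let ?h = "case_nat 0 (\<lambda>k. slot i (h k))"
  note lift = induced_path_slot[OF assms(1,3)]
  have bound: "h k < s" if "k \<le> length bs" for k
    using assms(1) that by (auto simp: induced_path_def)
  have h_eq_0: "h k = 0 \<longleftrightarrow> k = 0" if "k \<le> length bs" for k
    using assms(1,2) that unfolding induced_path_def by (metis atMost_iff inj_on_eq_iff zero_le)
  show ?thesis
    unfolding induced_path_def
  proof (intro conjI allI impI)
    show "inj_on ?h {..length (b # bs)}"
      using lift by (auto simp: inj_on_def induced_path_def split: nat.splits)
    show "?h ` {..length (b # bs)} \<subseteq> {..<fan_size}"
      using bound assms(3) fan_size_pos by (auto intro!: slot_bound split: nat.splits)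
  next
    fix k l assume "k \<le> length (b # bs)" "l \<le> length (b # bs)"
    then show "(?h k, ?h l) \<in> fan_arcs \<longleftrightarrow> path_arc (b # bs) k l"
      using lift bound h_eq_0 assms(3) by (auto simp: induced_path_def split: nat.splits)
  qed
qed

lemma fan_path_or_rooted_path:
  assumes "path_or_rooted_path ds bs s A"
  shows "path_or_rooted_path ds (b # bs) fan_size fan_arcs"
  unfolding path_or_rooted_path_def
proof
  fix c :: "nat \<Rightarrow> bool"
  let ?mono = "\<exists>h. induced_path fan_size fan_arcs ds h \<and> (\<forall>i\<le>length ds. c (h i) = c (h 0))"
  let ?rooted = "\<exists>h. induced_path fan_size fan_arcs (b # bs) h \<and> h 0 = 0 \<and>
    (\<forall>i\<le>length (b # bs). c (h i) = c 0)"
  show "?mono \<or> ?rooted"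
  proof (cases "\<exists>i\<le>length ds. c (slot i 0) = c 0")
    case False
    \<comment> \<open>With two colours, neighbours that all differ from the root agree with each
      other.\<close>
    then have ?mono using induced_path_neighbours by blast
    then show ?thesis ..
  next
    case True
    then obtain i where i: "i \<le> length ds" "c (slot i 0) = c 0" by blast
    \<comment> \<open>The hypothesis is applied to the colouring that \<open>c\<close> induces on
      block \<open>i\<close>.\<close>
    from assms consider
        h where "induced_path s A ds h" "\<forall>k\<le>length ds. c (slot i (h k)) = c (slot i (h 0))"
      | h where "induced_path s A bs h" "h 0 = 0" "\<forall>k\<le>length bs. c (slot i (h k)) = c (slot i 0)"
      unfolding path_or_rooted_path_def by (elim allE[of _ "\<lambda>x. c (slot i x)"]) blast
    then show ?thesis
    proof cases
      case 1
      then have ?mono using induced_path_slot[OF 1(1) i(1)] by blast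
      then show ?thesis ..
    next
      case 2
      have "\<forall>k\<le>length (b # bs). c (case_nat 0 (\<lambda>k. slot i (h k)) k) = c 0"
        using 2 i by (auto split: nat.splits)
      then have ?rooted
        using induced_path_Cons[OF 2(1,2) i(1)] by (metis old.nat.simps(4))
      then show ?thesis ..
    qed
  qed
qed

end

section \<open>Iterating the fan and translating back to \<open>P\<close>\<close>

lemma ex_path_or_rooted_path:
  "\<exists>n A r. 0 < n \<and> A \<subseteq> {..<n} \<times> {..<n} \<and> ranking A r \<and> noncrossing A \<and>
     path_or_rooted_path ds bs n A"
\<comment> \<open>The path is built from its far end: each further direction puts a new root in
  front, while \<open>ds\<close> stays fixed.\<close>
proof (induction bs)
  case Nil
  have "induced_path 1 {} [] (\<lambda>_. 0)"
    by (simp add: induced_path_def)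
  then have "path_or_rooted_path ds [] 1 {}"
    by (auto simp: path_or_rooted_path_def)
  then show ?case
    by (intro exI[of _ 1] exI[of _ "{}"]) (simp add: ranking_def noncrossing_def)
next
  case (Cons b bs)
  then obtain n A r where A: "0 < n" "A \<subseteq> {..<n} \<times> {..<n}" "ranking A r" "noncrossing A"
      "path_or_rooted_path ds bs n A"
    by blast
  interpret fan ds b n A r
    using A by unfold_locales
  show ?case
    using fan_size_pos fan_arcs_bounds fan_ranking fan_noncrossing fan_path_or_rooted_path[OF A(5)] by blast
qed

text \<open>Consecutive vertices are joined by exactly one arc, as anti-parallel arcs are excluded;
  so a missing forward arc means a backward one.\<close>

lemma oriented_path_directions:
  assumes "oriented_path P"
  obtains p ds where "distinct p" "verts P = set p" "length p = Suc (length ds)"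
    "\<And>i j. i < length p \<Longrightarrow> j < length p \<Longrightarrow> (p ! i, p ! j) \<in> arcs_ends P \<longleftrightarrow> path_arc ds i j"
proof -
  interpret oriented_graph P using assms by (simp add: oriented_path_def)
  obtain p where p: "p \<noteq> []" "distinct p" "verts P = set p"
      and edges: "uedges P = {{p ! i, p ! Suc i} | i. Suc i < length p}"
    using assms by (auto simp: oriented_path_def path_graph_def)
  define ds where "ds = map (\<lambda>i. (p ! i, p ! Suc i) \<in> arcs_ends P) [0..<length p - 1]"
  have len: "length p = Suc (length ds)"
    using p(1) by (simp add: ds_def)
  have nth: "ds ! i \<longleftrightarrow> (p ! i, p ! Suc i) \<in> arcs_ends P" if "Suc i < length p" for i
    using that by (simp add: ds_def less_diff_conv)
  have edge_iff: "{u, v} \<in> uedges P \<longleftrightarrow> (u, v) \<in> arcs_ends P \<or> (v, u) \<in> arcs_ends P" for u v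
    by (force simp: uedges_def arcs_ends_conv doubleton_eq_iff)
  have asym: "(v, u) \<notin> arcs_ends P" if "(u, v) \<in> arcs_ends P" for u v
    using asym_arcs_ends that by (rule asymD)
  have "(p ! i, p ! j) \<in> arcs_ends P \<longleftrightarrow> path_arc ds i j" if ij: "i < length p" "j < length p" for i j
  proof
    assume arc: "(p ! i, p ! j) \<in> arcs_ends P"
    then have "{p ! i, p ! j} \<in> uedges P" using edge_iff by blast
    then obtain k where "Suc k < length p" "{p ! i, p ! j} = {p ! k, p ! Suc k}"
      using edges by auto
    then have "i = k \<and> j = Suc k \<or> i = Suc k \<and> j = k"
      using ij p(2) by (auto simp: doubleton_eq_iff nth_eq_iff_index_eq)
    then show "path_arc ds i j"
      using arc asym[OF arc] nth ij len by (auto simp: path_arc_def)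
  next
    assume "path_arc ds i j"
    then consider "j = Suc i" "ds ! i" | "i = Suc j" "\<not> ds ! j"
      by (auto simp: path_arc_def)
    then show "(p ! i, p ! j) \<in> arcs_ends P"
    proof cases
      case 2
      then have "{p ! j, p ! i} \<in> uedges P" using edges ij by auto
      then show ?thesis using 2 nth ij edge_iff by blast
    qed (use nth ij in auto)
  qed
  then show ?thesis using that p len by blast
qed

theorem theorem3:
  fixes P :: "('a, 'b) pre_digraph"
  assumes "oriented_path P"
  shows "\<exists>D :: (nat, nat \<times> nat) pre_digraph.
           outerplanar_digraph D \<and> acyclic_digraph D \<and>
           (\<forall>c :: nat \<Rightarrow> bool. \<exists>H. induced_subgraph H D \<and> digraph_iso H P \<and>
              (\<forall>u\<in>verts H. \<forall>v\<in>verts H. c u = c v))"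
proof -
  obtain p ds where p: "distinct p" "verts P = set p" "length p = Suc (length ds)"
    and arcs: "\<And>i j. i < length p \<Longrightarrow> j < length p \<Longrightarrow> (p ! i, p ! j) \<in> arcs_ends P \<longleftrightarrow> path_arc ds i j"
    using oriented_path_directions[OF assms] by blast
  interpret oriented_graph P using assms by (simp add: oriented_path_def)
  obtain n A r where A: "A \<subseteq> {..<n} \<times> {..<n}" "ranking A r" "noncrossing A"
    and dichotomy: "path_or_rooted_path ds ds n A"
    using ex_path_or_rooted_path by blast
  let ?D = "arc_digraph n A"
  have "\<exists>H. induced_subgraph H ?D \<and> digraph_iso H P \<and> (\<forall>u\<in>verts H. \<forall>v\<in>verts H. c u = c v)"
    for c :: "nat \<Rightarrow> bool"
  proof -
    \<comment> \<open>In the rooted alternative \<open>h 0 = 0\<close>, so both alternatives yield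
      such an \<open>h\<close>.\<close>
    obtain h where h: "induced_path n A ds h" and mono: "\<forall>i\<le>length ds. c (h i) = c (h 0)"
      using dichotomy unfolding path_or_rooted_path_def by metis
    \<comment> \<open>The position of a vertex on the path, through which \<open>h\<close> becomes a
      map on the vertices of \<open>P\<close>.\<close>
    define idx where "idx = the_inv_into {..<length p} ((!) p)"
    have bij: "bij_betw ((!) p) {..<length p} (verts P)"
      using bij_betw_nth p(1,2) by blast
    have bij_idx: "bij_betw idx (verts P) {..length ds}"
      using bij_betw_the_inv_into[OF bij] p(3) by (simp add: idx_def lessThan_Suc_atMost)
    have nth_idx: "p ! idx v = v" if "v \<in> verts P" for v
      unfolding idx_def using bij that by (rule f_the_inv_into_f_bij_betw)
    have idx_le: "idx v \<le> length ds" if "v \<in> verts P" for v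
      using bij_idx that by (auto dest: bij_betwE)
    define g where "g = h \<circ> idx"
    have image: "g ` verts P = h ` {..length ds}"
      using bij_idx unfolding g_def image_comp[symmetric] by (simp add: bij_betw_def)
    have "inj_on g (verts P)"
      unfolding g_def using bij_idx h by (intro comp_inj_on) (auto simp: bij_betw_def induced_path_def)
    moreover have "(g u, g v) \<in> A \<longleftrightarrow> (u, v) \<in> arcs_ends P" if "u \<in> verts P" "v \<in> verts P" for u v
      using h arcs[of "idx u" "idx v"] idx_le[OF that(1)] idx_le[OF that(2)] nth_idx that p(3)
      by (simp add: g_def induced_path_def)
    ultimately have "digraph_iso (?D \<restriction> g ` verts P) P"
      using digraph_axioms by (intro digraph_iso_induce_arc_digraph)
    moreover have "induced_subgraph (?D \<restriction> g ` verts P) ?D"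
      using wf_arc_digraph[OF A(1)] h by (intro wf_digraph.induced_induce) (auto simp: image induced_path_def)
    moreover have "\<forall>u\<in>verts (?D \<restriction> g ` verts P). \<forall>v\<in>verts (?D \<restriction> g ` verts P). c u = c v"
      using mono unfolding image induce_subgraph_verts by (metis atMost_iff imageE)
    ultimately show ?thesis
      by blast
  qed
  then show ?thesis
    using outerplanar_arc_digraph[OF A] acyclic_arc_digraph[OF A(1,2)] by blast
qed

end
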